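(* Let $(X,f)$ be a topological dynamical system with a metric $d\in\mathscr{D}(X)$, and let $\varphi,\psi\in C(X,\mathbb{R})$ with $\psi>0$. Suppose that $\overline{\mathrm{mdim}}_{M}(X,f,d,\varphi)<\infty$. Then $\overline{\mathrm{mdim}}_{M,\psi}(X,f,d,\varphi)$ is the unique root $\beta\in\mathbb{R}$ of the equation $$\overline{\mathrm{mdim}}_{M}(X,f,d,\varphi-\beta\psi)=0.$$
   Context: A topological dynamical system (TDS) $(X,f)$ is a non-empty compact metrizable space $X$ with a continuous map $f:X\to X$. $\mathscr{D}(X)$ is the set of metrics on $X$ compatible with its topology; $C(X,\mathbb{R})$ is the set of real continuous functions on $X$. For $n\in\mathbb{N}$, $d_n(x,y)=\max_{0\le j\le n-1}d(f^jx,f^jy)$ and $S_n\varphi(x)=\sum_{i=0}^{n-1}\varphi(f^ix)$. For $\epsilon>0$ and $Z\subset X$, a set $F\subset Z$ is an $(n,\epsilon)$-separated set of $Z$ if $d_n(x,y)\ge\epsilon$ for all distinct $x,y\in F$. Upper metric mean dimension with potential $\varphi$: for $0<\epsilon<1$ let $$\#_{sep}(X,d_n,S_n\varphi,\epsilon)=\sup\Big\{\sum_{x\in F_n}(1/\epsilon)^{S_n\varphi(x)}: F_n \text{ is an } (n,\epsilon)\text{-separated set of } X\Big\},$$ $P(X,f,d,\varphi,\epsilon)=\limsup_{n\to\infty}\frac1n\log \#_{sep}(X,d_n,S_n\varphi,\epsilon)$, and $$\overline{\mathrm{mdim}}_M(X,f,d,\varphi)=\limsup_{\epsilon\to0}\frac{P(X,f,d,\varphi,\epsilon)}{\log\frac1\epsilon}.$$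 $\psi$-induced upper metric mean dimension with potential $\varphi$ (for $\psi>0$): for $T>0$ let $S_T=\{n\in\mathbb{N}:\exists x\in X,\ S_n\psi(x)\le T \text{ and } S_{n+1}\psi(x)>T\}$. For $n\in S_T$ let $X_n=\{x\in X:S_n\psi(x)\le T \text{ and } S_{n+1}\psi(x)>T\}$. For $\epsilon>0$ let $$P_{\psi,T}(X,f,d,\varphi,\epsilon)=\sup\Big\{\sum_{n\in S_T}\sum_{x\in F_n}(1/\epsilon)^{S_n\varphi(x)}: F_n\text{ is an }(n,\epsilon)\text{-separated set of }X_n,\ n\in S_T\Big\},$$ $$\overline{\mathrm{mdim}}_{M,\psi}(X,f,d,\varphi)=\limsup_{\epsilon\to0}\limsup_{T\to\infty}\frac{1}{T\log\frac1\epsilon}\log P_{\psi,T}(X,f,d,\varphi,\epsilon).$$ *)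

theory Defs
  imports "HOL-Analysis.Analysis"
begin

definition tds :: "'a topology \<Rightarrow> ('a \<Rightarrow> 'a) \<Rightarrow> bool" where
  "tds X f \<longleftrightarrow>
     topspace X \<noteq> {} \<and> compact_space X \<and> metrizable_space X \<and> continuous_map X X f"

definition compatible_metrics :: "'a topology \<Rightarrow> ('a \<Rightarrow> 'a \<Rightarrow> real) set" where
  "compatible_metrics X =
     {d. Metric_space (topspace X) d \<and> Metric_space.mtopology (topspace X) d = X}"

text \<open>Meaningful for \<open>n > 0\<close> only; the maximum of the empty set is unspecified.\<close>

definition bowen_dist :: "('a \<Rightarrow> 'a \<Rightarrow> real) \<Rightarrow> ('a \<Rightarrow> 'a) \<Rightarrow> nat \<Rightarrow> 'a \<Rightarrow> 'a \<Rightarrow> real" where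
  "bowen_dist d f n x y = Max ((\<lambda>j. d ((f ^^ j) x) ((f ^^ j) y)) ` {0..<n})"

definition birkhoff_sum :: "('a \<Rightarrow> 'a) \<Rightarrow> nat \<Rightarrow> ('a \<Rightarrow> real) \<Rightarrow> 'a \<Rightarrow> real" where
  "birkhoff_sum f n \<phi> x = (\<Sum>i<n. \<phi> ((f ^^ i) x))"

definition separated_set ::
  "('a \<Rightarrow> 'a \<Rightarrow> real) \<Rightarrow> ('a \<Rightarrow> 'a) \<Rightarrow> nat \<Rightarrow> real \<Rightarrow> 'a set \<Rightarrow> 'a set \<Rightarrow> bool" where
  "separated_set d f n \<epsilon> Z F \<longleftrightarrow>
     F \<subseteq> Z \<and> (\<forall>x\<in>F. \<forall>y\<in>F. x \<noteq> y \<longrightarrow> \<epsilon> \<le> bowen_dist d f n x y)"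

definition ereal_ln :: "ereal \<Rightarrow> ereal" where
  "ereal_ln x = (if x \<le> 0 then -\<infinity> else if x = \<infinity> then \<infinity> else ereal (ln (real_of_ereal x)))"

text \<open>In a TDS, for \<open>n > 0\<close> and \<open>\<epsilon> > 0\<close> every \<open>(n, \<epsilon>)\<close>-separated set is finite, so the sums
  over separated sets below are genuine finite sums.\<close>

definition sep_sum ::
  "'a topology \<Rightarrow> ('a \<Rightarrow> 'a) \<Rightarrow> ('a \<Rightarrow> 'a \<Rightarrow> real) \<Rightarrow> ('a \<Rightarrow> real) \<Rightarrow> nat \<Rightarrow> real \<Rightarrow> ereal" where
  "sep_sum X f d \<phi> n \<epsilon> =
     (SUP F \<in> {F. separated_set d f n \<epsilon> (topspace X) F}.
        ereal (\<Sum>x\<in>F. (1 / \<epsilon>) powr birkhoff_sum f n \<phi> x))"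

definition pressure ::
  "'a topology \<Rightarrow> ('a \<Rightarrow> 'a) \<Rightarrow> ('a \<Rightarrow> 'a \<Rightarrow> real) \<Rightarrow> ('a \<Rightarrow> real) \<Rightarrow> real \<Rightarrow> ereal" where
  "pressure X f d \<phi> \<epsilon> = limsup (\<lambda>n. ereal (1 / real n) * ereal_ln (sep_sum X f d \<phi> n \<epsilon>))"

definition upper_mdim ::
  "'a topology \<Rightarrow> ('a \<Rightarrow> 'a) \<Rightarrow> ('a \<Rightarrow> 'a \<Rightarrow> real) \<Rightarrow> ('a \<Rightarrow> real) \<Rightarrow> ereal" where
  "upper_mdim X f d \<phi> = Limsup (at_right 0) (\<lambda>\<epsilon>. pressure X f d \<phi> \<epsilon> / ereal (ln (1 / \<epsilon>)))"

definition exit_set ::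
  "'a topology \<Rightarrow> ('a \<Rightarrow> 'a) \<Rightarrow> ('a \<Rightarrow> real) \<Rightarrow> real \<Rightarrow> nat \<Rightarrow> 'a set" where
  "exit_set X f \<psi> T n =
     {x \<in> topspace X. birkhoff_sum f n \<psi> x \<le> T \<and> birkhoff_sum f (Suc n) \<psi> x > T}"

text \<open>Times are positive integers. For continuous \<open>\<psi> > 0\<close> on a TDS there are only finitely many
  exit times, and excluding \<open>n = 0\<close> has no effect once \<open>T \<ge> max \<psi>\<close>.\<close>

definition exit_times ::
  "'a topology \<Rightarrow> ('a \<Rightarrow> 'a) \<Rightarrow> ('a \<Rightarrow> real) \<Rightarrow> real \<Rightarrow> nat set" where
  "exit_times X f \<psi> T =
     {n. n > 0 \<and> (\<exists>x\<in>topspace X. birkhoff_sum f n \<psi> x \<le> T \<and> birkhoff_sum f (Suc n) \<psi> x > T)}"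

definition induced_sep_sum ::
  "'a topology \<Rightarrow> ('a \<Rightarrow> 'a) \<Rightarrow> ('a \<Rightarrow> 'a \<Rightarrow> real) \<Rightarrow> ('a \<Rightarrow> real) \<Rightarrow> ('a \<Rightarrow> real)
    \<Rightarrow> real \<Rightarrow> real \<Rightarrow> ereal" where
  "induced_sep_sum X f d \<psi> \<phi> T \<epsilon> =
     (SUP F \<in> {F. \<forall>n\<in>exit_times X f \<psi> T. separated_set d f n \<epsilon> (exit_set X f \<psi> T n) (F n)}.
        ereal (\<Sum>n\<in>exit_times X f \<psi> T. \<Sum>x\<in>F n. (1 / \<epsilon>) powr birkhoff_sum f n \<phi> x))"

definition induced_upper_mdim ::
  "'a topology \<Rightarrow> ('a \<Rightarrow> 'a) \<Rightarrow> ('a \<Rightarrow> 'a \<Rightarrow> real) \<Rightarrow> ('a \<Rightarrow> real) \<Rightarrow> ('a \<Rightarrow> real) \<Rightarrow> ereal" where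
  "induced_upper_mdim X f d \<psi> \<phi> =
     Limsup (at_right 0) (\<lambda>\<epsilon>. Limsup at_top (\<lambda>T.
       ereal (1 / (T * ln (1 / \<epsilon>))) * ereal_ln (induced_sep_sum X f d \<psi> \<phi> T \<epsilon>)))"

end

(* Write g(b) for the upper metric mean dimension with potential phi - b psi.  If m \<le> psi \<le> M
   with m > 0, then g decreases with slope between -M and -m, so it has exactly one zero.  A point
   of the exit set X_n at level T has S_n psi in (T - M, T], hence its weights for phi and for
   phi - b psi differ by the factor (1/eps)^(b T) up to a constant.  If g(b) < 0, the sums for
   phi - b psi decay geometrically in n, and summing over the exit times bounds the induced quantity
   by b.  If g(b) > 0, infinitely many separated sets have exponentially large weight for
   phi - b psi; each is cut into O(n) pieces on which S_n psi varies by less than m, and every piece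
   lies in one exit set, so the induced quantity is at least b. *)
theory Submission
  imports Defs "HOL-Real_Asymp.Real_Asymp"
begin

section \<open>Growth rates turned into bounds on sums\<close>

text \<open>The convention that \<open>ereal_ln\<close> is -infinity at and below 0 makes this hold
  for every extended real \<open>s\<close>, so no sign conditions arise later.\<close>

lemma ereal_ln_le_iff: "ereal_ln s \<le> ereal r \<longleftrightarrow> s \<le> ereal (exp r)"
proof (cases s)
  case (real x)
  have "ln x \<le> r \<longleftrightarrow> x \<le> exp r" if "x > 0"
    using that by (metis exp_gt_zero exp_ln ln_exp ln_le_cancel_iff)
  moreover have "x \<le> exp r" if "x \<le> 0"
    using that exp_gt_zero[of r] by linarith
  ultimately show ?thesis
    using real by (auto simp: ereal_ln_def)
qed (auto simp: ereal_ln_def)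

text \<open>Unpacks both growth rates: \<open>c\<close> will be \<open>1 / real n\<close> in the
  pressure and \<open>1 / (T * ln (1 / \<epsilon>))\<close> in the induced quantity.\<close>

lemma scaled_ereal_ln_le_iff:
  assumes "c > 0"
  shows "ereal c * ereal_ln s \<le> ereal b \<longleftrightarrow> s \<le> ereal (exp (b / c))"
proof -
  have "ereal c * ereal_ln s \<le> ereal b \<longleftrightarrow> ereal_ln s \<le> ereal (b / c)"
    using assms by (cases "ereal_ln s") (auto simp: field_simps)
  then show ?thesis
    by (simp add: ereal_ln_le_iff)
qed

lemma eventually_at_right_0_less_1: "eventually (\<lambda>\<epsilon>::real. 0 < \<epsilon> \<and> \<epsilon> < 1) (at_right 0)"
  unfolding eventually_at_right[OF zero_less_one] by (auto intro: exI[of _ 1])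

lemma ereal_divide_less_iff: "l > 0 \<Longrightarrow> p / ereal l < ereal a \<longleftrightarrow> p < ereal (a * l)"
  by (cases p) (auto simp: divide_less_eq)

lemma ereal_divide_le_iff: "l > 0 \<Longrightarrow> p / ereal l \<le> ereal a \<longleftrightarrow> p \<le> ereal (a * l)"
  by (cases p) (auto simp: divide_le_eq)

text \<open>A real \<open>a'\<close> strictly between the dimension and \<open>a\<close> survives
  both limsups as an eventual bound on the sums. Keeping \<open>a' < a\<close> later yields strict
  inequalities and a geometric ratio below 1.\<close>

lemma upper_mdim_lessD:
  assumes "upper_mdim X f d \<phi> < ereal a"
  obtains a' where "a' < a"
    "eventually (\<lambda>\<epsilon>. eventually (\<lambda>n. sep_sum X f d \<phi> n \<epsilon> \<le> ereal ((1 / \<epsilon>) powr (a' * real n)))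
       sequentially) (at_right 0)"
proof -
  obtain a' where a': "upper_mdim X f d \<phi> < ereal a'" "a' < a"
    using ereal_dense2[OF assms] by auto
  from a'(1) have "eventually (\<lambda>\<epsilon>. pressure X f d \<phi> \<epsilon> / ereal (ln (1 / \<epsilon>)) < ereal a') (at_right 0)"
    unfolding upper_mdim_def by (rule Limsup_lessD)
  then have "eventually (\<lambda>\<epsilon>. eventually (\<lambda>n. sep_sum X f d \<phi> n \<epsilon> \<le> ereal ((1 / \<epsilon>) powr (a' * real n)))
       sequentially) (at_right 0)"
    using eventually_at_right_0_less_1
  proof eventually_elim
    case (elim \<epsilon>)
    then have "ln (1 / \<epsilon>) > 0" by simp
    with elim have "pressure X f d \<phi> \<epsilon> < ereal (a' * ln (1 / \<epsilon>))"
      by (simp only: ereal_divide_less_iff)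
    then have "eventually (\<lambda>n. ereal (1 / real n) * ereal_ln (sep_sum X f d \<phi> n \<epsilon>)
        < ereal (a' * ln (1 / \<epsilon>))) sequentially"
      unfolding pressure_def by (rule Limsup_lessD)
    then show ?case
      \<comment> \<open>At \<open>n = 0\<close> the factor \<open>1 / real n\<close> is 0 and
        \<open>scaled_ereal_ln_le_iff\<close> does not apply.\<close>
      using eventually_gt_at_top[of 0]
    proof eventually_elim
      case (elim n)
      then have "sep_sum X f d \<phi> n \<epsilon> \<le> ereal (exp (a' * ln (1 / \<epsilon>) / (1 / real n)))"
        by (subst scaled_ereal_ln_le_iff[symmetric]) auto
      then show ?case
        using \<open>0 < \<epsilon> \<and> \<epsilon> < 1\<close> by (simp add: powr_def mult_ac)
    qed
  qed
  with a' that show thesis by blast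
qed

text \<open>Partial converse of \<open>upper_mdim_lessD\<close>: both limsups preserve a non-strict
  eventual bound.\<close>

lemma upper_mdim_leI:
  assumes "eventually (\<lambda>\<epsilon>. eventually (\<lambda>n. sep_sum X f d \<phi> n \<epsilon> \<le> ereal ((1 / \<epsilon>) powr (a * real n)))
       sequentially) (at_right 0)"
  shows "upper_mdim X f d \<phi> \<le> ereal a"
  unfolding upper_mdim_def
proof (rule Limsup_bounded)
  show "eventually (\<lambda>\<epsilon>. pressure X f d \<phi> \<epsilon> / ereal (ln (1 / \<epsilon>)) \<le> ereal a) (at_right 0)"
    using assms eventually_at_right_0_less_1
  proof eventually_elim
    case (elim \<epsilon>)
    then have ln: "ln (1 / \<epsilon>) > 0" by simp
    have "pressure X f d \<phi> \<epsilon> \<le> ereal (a * ln (1 / \<epsilon>))"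
      unfolding pressure_def
    proof (rule Limsup_bounded)
      show "eventually (\<lambda>n. ereal (1 / real n) * ereal_ln (sep_sum X f d \<phi> n \<epsilon>)
        \<le> ereal (a * ln (1 / \<epsilon>))) sequentially"
        using elim(1) eventually_gt_at_top[of 0]
      proof eventually_elim
        case (elim n)
        then show ?case
          using \<open>0 < \<epsilon> \<and> \<epsilon> < 1\<close>
          by (subst scaled_ereal_ln_le_iff) (auto simp: powr_def mult_ac)
      qed
    qed
    with ln show ?case
      by (simp only: ereal_divide_le_iff)
  qed
qed

lemma birkhoff_sum_Suc:
  "birkhoff_sum f (Suc n) \<phi> x = birkhoff_sum f n \<phi> x + \<phi> ((f ^^ n) x)"
  by (simp add: birkhoff_sum_def)

lemma birkhoff_sum_diff_scaled:
  "birkhoff_sum f n (\<lambda>x. \<phi> x - c * \<psi> x) x = birkhoff_sum f n \<phi> x - c * birkhoff_sum f n \<psi> x"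
  by (simp add: birkhoff_sum_def sum_subtractf sum_distrib_left)

lemma sum_powr_le_sep_sum:
  assumes "separated_set d f n \<epsilon> (topspace X) F"
  shows "ereal (\<Sum>x\<in>F. (1 / \<epsilon>) powr birkhoff_sum f n \<phi> x) \<le> sep_sum X f d \<phi> n \<epsilon>"
  unfolding sep_sum_def using assms by (intro SUP_upper) auto

section \<open>Dependence of the upper metric mean dimension on the potential\<close>

locale self_map =
  fixes X :: "'a topology" and f :: "'a \<Rightarrow> 'a"
  assumes maps: "x \<in> topspace X \<Longrightarrow> f x \<in> topspace X"
begin

lemma funpow_in_topspace: "x \<in> topspace X \<Longrightarrow> (f ^^ i) x \<in> topspace X"
  by (induction i) (auto intro: maps)

lemma birkhoff_sum_mono:
  assumes "\<And>x. x \<in> topspace X \<Longrightarrow> \<phi> x \<le> \<theta> x + c" "x \<in> topspace X"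
  shows "birkhoff_sum f n \<phi> x \<le> birkhoff_sum f n \<theta> x + c * real n"
proof -
  have "birkhoff_sum f n \<phi> x \<le> (\<Sum>i<n. \<theta> ((f ^^ i) x) + c)"
    unfolding birkhoff_sum_def using assms funpow_in_topspace by (intro sum_mono) auto
  then show ?thesis
    by (simp add: birkhoff_sum_def sum.distrib mult.commute)
qed

lemma birkhoff_sum_le:
  assumes "\<And>x. x \<in> topspace X \<Longrightarrow> \<phi> x \<le> c" "x \<in> topspace X"
  shows "birkhoff_sum f n \<phi> x \<le> c * real n"
  using birkhoff_sum_mono[of \<phi> "\<lambda>_. 0" c x n] assms by (simp add: birkhoff_sum_def)

lemma birkhoff_sum_ge:
  assumes "\<And>x. x \<in> topspace X \<Longrightarrow> c \<le> \<phi> x" "x \<in> topspace X"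
  shows "c * real n \<le> birkhoff_sum f n \<phi> x"
  using birkhoff_sum_mono[of "\<lambda>_. 0" \<phi> "- c" x n] assms
  by (fastforce simp: birkhoff_sum_def)

text \<open>As \<open>1 / \<epsilon>\<close> exceeds 1, an error \<open>c\<close> per step
  multiplies each weight by at most \<open>(1 / \<epsilon>) powr (c * real n)\<close>, which shifts
  the exponential rate by \<open>c\<close>.\<close>

lemma sep_sum_mono:
  assumes "\<And>x. x \<in> topspace X \<Longrightarrow> \<phi> x \<le> \<theta> x + c" "0 < \<epsilon>" "\<epsilon> < 1"
    and le: "sep_sum X f d \<theta> n \<epsilon> \<le> ereal ((1 / \<epsilon>) powr (a * real n))"
  shows "sep_sum X f d \<phi> n \<epsilon> \<le> ereal ((1 / \<epsilon>) powr ((a + c) * real n))"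
  unfolding sep_sum_def
proof (rule SUP_least)
  fix F assume "F \<in> {F. separated_set d f n \<epsilon> (topspace X) F}"
  then have F: "separated_set d f n \<epsilon> (topspace X) F" "F \<subseteq> topspace X"
    by (auto simp: separated_set_def)
  have "(\<Sum>x\<in>F. (1 / \<epsilon>) powr birkhoff_sum f n \<phi> x)
      \<le> (\<Sum>x\<in>F. (1 / \<epsilon>) powr (birkhoff_sum f n \<theta> x + c * real n))"
    using F assms birkhoff_sum_mono[of \<phi> \<theta> c] by (intro sum_mono powr_mono) auto
  also have "\<dots> = (\<Sum>x\<in>F. (1 / \<epsilon>) powr birkhoff_sum f n \<theta> x) * (1 / \<epsilon>) powr (c * real n)"
    by (simp add: powr_add sum_distrib_right)
  also have "\<dots> \<le> (1 / \<epsilon>) powr (a * real n) * (1 / \<epsilon>) powr (c * real n)"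
    using order_trans[OF sum_powr_le_sep_sum[OF F(1), of \<theta>] le] by (intro mult_right_mono) auto
  also have "\<dots> = (1 / \<epsilon>) powr ((a + c) * real n)"
    by (simp add: powr_add distrib_right)
  finally show "ereal (\<Sum>x\<in>F. (1 / \<epsilon>) powr birkhoff_sum f n \<phi> x)
      \<le> ereal ((1 / \<epsilon>) powr ((a + c) * real n))" by simp
qed

text \<open>The source of both slope estimates in \<open>b\<close> for the potential
  \<open>\<phi> - b \<psi>\<close>, since \<open>c\<close> may have either sign.\<close>

lemma upper_mdim_mono:
  assumes "\<And>x. x \<in> topspace X \<Longrightarrow> \<phi> x \<le> \<theta> x + c" "upper_mdim X f d \<theta> < ereal a"
  shows "upper_mdim X f d \<phi> < ereal (a + c)"
proof -
  obtain a' where a': "a' < a" and ev: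
    "eventually (\<lambda>\<epsilon>. eventually (\<lambda>n. sep_sum X f d \<theta> n \<epsilon> \<le> ereal ((1 / \<epsilon>) powr (a' * real n)))
       sequentially) (at_right 0)"
    using upper_mdim_lessD[OF assms(2)] by blast
  have "upper_mdim X f d \<phi> \<le> ereal (a' + c)"
  proof (rule upper_mdim_leI)
    show "eventually (\<lambda>\<epsilon>. eventually (\<lambda>n. sep_sum X f d \<phi> n \<epsilon> \<le> ereal ((1 / \<epsilon>) powr ((a' + c) * real n)))
       sequentially) (at_right 0)"
      using ev eventually_at_right_0_less_1
    proof eventually_elim
      case (elim \<epsilon>)
      show ?case
        using elim(1) by eventually_elim (use elim assms(1) in \<open>auto intro: sep_sum_mono\<close>)
    qed
  qed
  also have "\<dots> < ereal (a + c)" using a' by simp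
  finally show ?thesis .
qed

text \<open>A single point is separated at every scale and has weight at least
  \<open>(1 / \<epsilon>) powr (c * real n)\<close>. This excludes the value -infinity.\<close>

lemma upper_mdim_ge:
  assumes ne: "topspace X \<noteq> {}" and c: "\<And>x. x \<in> topspace X \<Longrightarrow> c \<le> \<phi> x"
  shows "ereal c \<le> upper_mdim X f d \<phi>"
proof (rule ccontr)
  assume "\<not> ?thesis"
  then have "upper_mdim X f d \<phi> < ereal c" by simp
  then obtain a where a: "a < c" and ev:
    "eventually (\<lambda>\<epsilon>. eventually (\<lambda>n. sep_sum X f d \<phi> n \<epsilon> \<le> ereal ((1 / \<epsilon>) powr (a * real n)))
       sequentially) (at_right 0)"
    using upper_mdim_lessD by blast
  obtain \<epsilon> where \<epsilon>: "0 < \<epsilon>" "\<epsilon> < 1" and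
    ev': "eventually (\<lambda>n. sep_sum X f d \<phi> n \<epsilon> \<le> ereal ((1 / \<epsilon>) powr (a * real n))) sequentially"
    using eventually_happens[OF eventually_conj[OF ev eventually_at_right_0_less_1]]
    by (auto simp: trivial_limit_at_right_real)
  obtain n where n: "n > 0" and le: "sep_sum X f d \<phi> n \<epsilon> \<le> ereal ((1 / \<epsilon>) powr (a * real n))"
    using eventually_happens[OF eventually_conj[OF ev' eventually_gt_at_top[of 0]]] by auto
  obtain x where x: "x \<in> topspace X" using ne by blast
  have "separated_set d f n \<epsilon> (topspace X) {x}"
    using x by (simp add: separated_set_def)
  from order_trans[OF sum_powr_le_sep_sum[OF this, of \<phi>] le]
  have "birkhoff_sum f n \<phi> x \<le> a * real n"
    using \<epsilon> by simp
  with birkhoff_sum_ge[of c \<phi> x n, OF c x] have "c * real n \<le> a * real n" by simp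
  with a n show False by simp
qed

end

section \<open>Exit times and induced sums for a roof function between \<open>m\<close> and
  \<open>M\<close>\<close>

locale positive_roof = self_map +
  fixes \<psi> :: "'a \<Rightarrow> real" and m M :: real
  assumes m_pos: "0 < m" and M_pos: "0 < M"
    and roof_ge: "x \<in> topspace X \<Longrightarrow> m \<le> \<psi> x"
    and roof_le: "x \<in> topspace X \<Longrightarrow> \<psi> x \<le> M"
begin

lemma roof_sum_ge: "x \<in> topspace X \<Longrightarrow> m * real n \<le> birkhoff_sum f n \<psi> x"
  using birkhoff_sum_ge roof_ge by blast

lemma roof_sum_le: "x \<in> topspace X \<Longrightarrow> birkhoff_sum f n \<psi> x \<le> M * real n"
  using birkhoff_sum_le roof_le by blast

lemma exit_times_upper:
  assumes "n \<in> exit_times X f \<psi> T"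
  shows "m * real n \<le> T"
proof -
  from assms obtain x where "x \<in> topspace X" "birkhoff_sum f n \<psi> x \<le> T"
    by (auto simp: exit_times_def)
  with roof_sum_ge[of x n] show ?thesis by linarith
qed

text \<open>Exit times are all large when \<open>T\<close> is large, so a bound on
  \<open>sep_sum\<close> valid from some \<open>N\<close> on covers every term of the induced
  sum.\<close>

lemma exit_times_lower:
  assumes "n \<in> exit_times X f \<psi> T"
  shows "T < M * real (Suc n)"
proof -
  from assms obtain x where "x \<in> topspace X" "T < birkhoff_sum f (Suc n) \<psi> x"
    by (auto simp: exit_times_def)
  with roof_sum_le[of x "Suc n"] show ?thesis by linarith
qed

lemma finite_exit_times: "finite (exit_times X f \<psi> T)"
proof (rule finite_subset)
  show "exit_times X f \<psi> T \<subseteq> {..nat \<lfloor>T / m\<rfloor>}"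
  proof
    fix n assume "n \<in> exit_times X f \<psi> T"
    then have "real n \<le> T / m"
      using exit_times_upper[of n T] m_pos by (simp add: field_simps)
    then show "n \<in> {..nat \<lfloor>T / m\<rfloor>}"
      by (simp add: le_nat_floor)
  qed
qed simp

text \<open>The family that is \<open>F\<close> at time \<open>n\<close> and empty elsewhere
  competes in the supremum. A nonempty \<open>F\<close> forces \<open>n\<close> to be an exit
  time.\<close>

lemma sum_powr_le_induced_sep_sum:
  assumes "n > 0" "separated_set d f n \<epsilon> (exit_set X f \<psi> T n) F"
  shows "ereal (\<Sum>x\<in>F. (1 / \<epsilon>) powr birkhoff_sum f n \<phi> x) \<le> induced_sep_sum X f d \<psi> \<phi> T \<epsilon>"
proof (cases "F = {}")
  case True
  \<comment> \<open>The all-empty family shows that the induced sum is at least 0, even if there are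
    no exit times.\<close>
  have "ereal (\<Sum>k\<in>exit_times X f \<psi> T. \<Sum>x\<in>{}. (1 / \<epsilon>) powr birkhoff_sum f k \<phi> x)
      \<le> induced_sep_sum X f d \<psi> \<phi> T \<epsilon>"
    unfolding induced_sep_sum_def
    by (rule SUP_upper2[where i = "\<lambda>_. {}"]) (auto simp: separated_set_def)
  with True show ?thesis by simp
next
  case False
  define G where "G = (\<lambda>k. if k = n then F else {})"
  have n: "n \<in> exit_times X f \<psi> T"
    using False assms by (auto simp: exit_times_def exit_set_def separated_set_def)
  have "(\<Sum>k\<in>exit_times X f \<psi> T. \<Sum>x\<in>G k. (1 / \<epsilon>) powr birkhoff_sum f k \<phi> x)
      = (\<Sum>k\<in>exit_times X f \<psi> T. if k = n then \<Sum>x\<in>F. (1 / \<epsilon>) powr birkhoff_sum f n \<phi> x else 0)"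
    by (intro sum.cong) (auto simp: G_def)
  also have "\<dots> = (\<Sum>x\<in>F. (1 / \<epsilon>) powr birkhoff_sum f n \<phi> x)"
    using n finite_exit_times by simp
  finally show ?thesis
    unfolding induced_sep_sum_def
    using assms by (intro SUP_upper2[where i = G]) (auto simp: G_def separated_set_def)
qed

section \<open>Upper bound for the induced dimension\<close>

text \<open>Replacing \<open>\<phi>\<close> by \<open>\<phi> - b \<psi>\<close> on an exit set costs
  the factor \<open>(1 / \<epsilon>) powr (b * T)\<close>, up to an error
  \<open>\<bar>b\<bar> * M\<close> in the exponent. What remains at time \<open>n\<close> is at most
  the \<open>n\<close>-th term of a geometric series.\<close>

lemma induced_sep_sum_le:
  assumes \<epsilon>: "0 < \<epsilon>" "\<epsilon> < 1" and "a < 0"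
    and N: "\<And>n. n \<ge> N \<Longrightarrow>
      sep_sum X f d (\<lambda>x. \<phi> x - b * \<psi> x) n \<epsilon> \<le> ereal ((1 / \<epsilon>) powr (a * real n))"
    and T: "M * real N < T"
  shows "induced_sep_sum X f d \<psi> \<phi> T \<epsilon>
    \<le> ereal ((1 / \<epsilon>) powr (b * T + \<bar>b\<bar> * M) / (1 - (1 / \<epsilon>) powr a))"
  unfolding induced_sep_sum_def
proof (rule SUP_least)
  fix F assume "F \<in> {F. \<forall>n\<in>exit_times X f \<psi> T. separated_set d f n \<epsilon> (exit_set X f \<psi> T n) (F n)}"
  then have F: "\<And>n. n \<in> exit_times X f \<psi> T \<Longrightarrow> separated_set d f n \<epsilon> (exit_set X f \<psi> T n) (F n)"
    by auto
  define C where "C = (1 / \<epsilon>) powr (b * T + \<bar>b\<bar> * M)"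
  define q where "q = (1 / \<epsilon>) powr a"
  have q: "0 < q" "q < 1"
    using \<epsilon> \<open>a < 0\<close> powr_less_mono[of a 0 "1 / \<epsilon>"] by (auto simp: q_def)
  have bound: "(\<Sum>x\<in>F n. (1 / \<epsilon>) powr birkhoff_sum f n \<phi> x) \<le> C * q ^ n"
    if n: "n \<in> exit_times X f \<psi> T" for n
  proof -
    have Fn: "F n \<subseteq> exit_set X f \<psi> T n"
      using F[OF n] by (simp add: separated_set_def)
    then have sep: "separated_set d f n \<epsilon> (topspace X) (F n)"
      using F[OF n] by (auto simp: separated_set_def exit_set_def)
    \<comment> \<open>The lower bound on exit times involves \<open>Suc n\<close>, and
      \<open>N < Suc n\<close> still gives \<open>N \<le> n\<close>.\<close>
    have "M * real N < M * real (Suc n)" using T exit_times_lower[OF n] by linarith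
    then have "n \<ge> N" using M_pos by simp
    have "(\<Sum>x\<in>F n. (1 / \<epsilon>) powr birkhoff_sum f n \<phi> x)
        \<le> (\<Sum>x\<in>F n. C * (1 / \<epsilon>) powr birkhoff_sum f n (\<lambda>x. \<phi> x - b * \<psi> x) x)"
    proof (rule sum_mono)
      fix x assume "x \<in> F n"
      with Fn have x: "x \<in> topspace X" "birkhoff_sum f n \<psi> x \<le> T" "T < birkhoff_sum f (Suc n) \<psi> x"
        by (auto simp: exit_set_def)
      then have "\<bar>birkhoff_sum f n \<psi> x - T\<bar> \<le> M"
        using roof_le[OF funpow_in_topspace[OF x(1), of n]] by (simp add: birkhoff_sum_Suc)
      then have "\<bar>b\<bar> * \<bar>birkhoff_sum f n \<psi> x - T\<bar> \<le> \<bar>b\<bar> * M"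
        by (intro mult_left_mono) auto
      then have "b * (birkhoff_sum f n \<psi> x - T) \<le> \<bar>b\<bar> * M"
        by (metis abs_ge_self abs_mult order_trans)
      then have "birkhoff_sum f n \<phi> x
          \<le> (b * T + \<bar>b\<bar> * M) + birkhoff_sum f n (\<lambda>x. \<phi> x - b * \<psi> x) x"
        by (simp add: birkhoff_sum_diff_scaled algebra_simps)
      then show "(1 / \<epsilon>) powr birkhoff_sum f n \<phi> x
          \<le> C * (1 / \<epsilon>) powr birkhoff_sum f n (\<lambda>x. \<phi> x - b * \<psi> x) x"
        unfolding C_def powr_add[symmetric] using \<epsilon> by (intro powr_mono) auto
    qed
    also have "\<dots> = C * (\<Sum>x\<in>F n. (1 / \<epsilon>) powr birkhoff_sum f n (\<lambda>x. \<phi> x - b * \<psi> x) x)"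
      by (simp add: sum_distrib_left)
    also have "\<dots> \<le> C * (1 / \<epsilon>) powr (a * real n)"
      using order_trans[OF sum_powr_le_sep_sum[OF sep] N[OF \<open>n \<ge> N\<close>]]
      by (intro mult_left_mono) (auto simp: C_def)
    also have "\<dots> = C * q ^ n"
      using q by (simp add: q_def powr_powr[symmetric] powr_realpow)
    finally show ?thesis .
  qed
  have "(\<Sum>n\<in>exit_times X f \<psi> T. \<Sum>x\<in>F n. (1 / \<epsilon>) powr birkhoff_sum f n \<phi> x)
      \<le> (\<Sum>n\<in>exit_times X f \<psi> T. C * q ^ n)"
    by (intro sum_mono bound)
  also have "\<dots> = C * (\<Sum>n\<in>exit_times X f \<psi> T. q ^ n)"
    by (simp add: sum_distrib_left)
  \<comment> \<open>Passing to the full series makes this factor independent of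
    \<open>T\<close>.\<close>
  also have "\<dots> \<le> C * (\<Sum>n. q ^ n)"
    using q finite_exit_times by (intro mult_left_mono sum_le_suminf) (auto simp: C_def)
  also have "\<dots> = C / (1 - q)"
    using q by (simp add: suminf_geometric)
  finally show "ereal (\<Sum>n\<in>exit_times X f \<psi> T. \<Sum>x\<in>F n. (1 / \<epsilon>) powr birkhoff_sum f n \<phi> x)
      \<le> ereal ((1 / \<epsilon>) powr (b * T + \<bar>b\<bar> * M) / (1 - (1 / \<epsilon>) powr a))"
    by (simp add: C_def q_def)
qed

text \<open>The gap between \<open>b\<close> and \<open>b'\<close> absorbs the constant left by
  \<open>induced_sep_sum_le\<close>.\<close>

lemma induced_upper_mdim_le:
  assumes "upper_mdim X f d (\<lambda>x. \<phi> x - b * \<psi> x) < 0" "b < b'"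
  shows "induced_upper_mdim X f d \<psi> \<phi> \<le> ereal b'"
proof -
  obtain a where a: "a < 0" and ev:
    "eventually (\<lambda>\<epsilon>. eventually (\<lambda>n. sep_sum X f d (\<lambda>x. \<phi> x - b * \<psi> x) n \<epsilon>
        \<le> ereal ((1 / \<epsilon>) powr (a * real n))) sequentially) (at_right 0)"
    using upper_mdim_lessD[of X f d "\<lambda>x. \<phi> x - b * \<psi> x" 0] assms(1)
    by (auto simp: zero_ereal_def)
  show ?thesis
    unfolding induced_upper_mdim_def
  proof (rule Limsup_bounded)
    show "eventually (\<lambda>\<epsilon>. Limsup at_top (\<lambda>T. ereal (1 / (T * ln (1 / \<epsilon>))) *
        ereal_ln (induced_sep_sum X f d \<psi> \<phi> T \<epsilon>)) \<le> ereal b') (at_right 0)"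
      using ev eventually_at_right_0_less_1
    proof eventually_elim
      case (elim \<epsilon>)
      then have ln: "ln (1 / \<epsilon>) > 0" and \<epsilon>: "0 < \<epsilon>" "\<epsilon> < 1" by auto
      obtain N where N: "\<And>n. n \<ge> N \<Longrightarrow> sep_sum X f d (\<lambda>x. \<phi> x - b * \<psi> x) n \<epsilon>
          \<le> ereal ((1 / \<epsilon>) powr (a * real n))"
        using elim(1) by (auto simp: eventually_sequentially)
      \<comment> \<open>Everything in the bound except \<open>(1 / \<epsilon>) powr (b * T)\<close>;
        it depends on \<open>\<epsilon>\<close> but not on \<open>T\<close>.\<close>
      define C where "C = (1 / \<epsilon>) powr (\<bar>b\<bar> * M) / (1 - (1 / \<epsilon>) powr a)"
      have "filterlim (\<lambda>T. (1 / \<epsilon>) powr ((b' - b) * T)) at_top at_top"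
        using \<epsilon> ln assms(2) unfolding powr_def
        by (auto intro!: filterlim_compose[OF exp_at_top]
            filterlim_tendsto_pos_mult_at_top[OF tendsto_const] filterlim_ident
            simp: mult.commute[of _ "ln _"] mult.assoc[symmetric])
      then have "eventually (\<lambda>T. C \<le> (1 / \<epsilon>) powr ((b' - b) * T)) at_top"
        by (simp add: filterlim_at_top)
      then have "eventually (\<lambda>T. ereal (1 / (T * ln (1 / \<epsilon>))) *
          ereal_ln (induced_sep_sum X f d \<psi> \<phi> T \<epsilon>) \<le> ereal b') at_top"
        using eventually_gt_at_top[of 0] eventually_gt_at_top[of "M * real N"]
      proof eventually_elim
        case (elim T)
        have "induced_sep_sum X f d \<psi> \<phi> T \<epsilon> \<le> ereal ((1 / \<epsilon>) powr (b * T) * C)"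
          using induced_sep_sum_le[OF \<epsilon> a N elim(3)] by (simp add: C_def powr_add)
        also have "\<dots> \<le> ereal ((1 / \<epsilon>) powr (b * T) * (1 / \<epsilon>) powr ((b' - b) * T))"
          using elim(1) by (simp add: mult_left_mono)
        also have "\<dots> = ereal (exp (b' / (1 / (T * ln (1 / \<epsilon>)))))"
          unfolding powr_add[symmetric] using \<epsilon> by (simp add: powr_def algebra_simps)
        finally show ?case
          using elim(2) ln by (subst scaled_ereal_ln_le_iff) auto
      qed
      then show ?case by (rule Limsup_bounded)
    qed
  qed
qed

section \<open>Lower bound for the induced dimension\<close>

text \<open>Each piece of a separated set on which \<open>birkhoff_sum f n \<psi>\<close> lies in
  \<open>(m * (k - 1), m * k]\<close> sits in the exit set of level \<open>m * k\<close> at time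
  \<open>n\<close>, so the induced bound controls it. The number of pieces is linear in
  \<open>n\<close>.\<close>

lemma sep_sum_le_of_induced:
  assumes \<epsilon>: "0 < \<epsilon>" "\<epsilon> < 1" and "n > 0"
    and T0: "\<And>T. T \<ge> m * real n \<Longrightarrow> induced_sep_sum X f d \<psi> \<phi> T \<epsilon> \<le> ereal ((1 / \<epsilon>) powr (b * T))"
  shows "sep_sum X f d (\<lambda>x. \<phi> x - b * \<psi> x) n \<epsilon>
    \<le> ereal ((M / m * real n + 2) * (1 / \<epsilon>) powr (\<bar>b\<bar> * m))"
  unfolding sep_sum_def
proof (rule SUP_least)
  fix F assume "F \<in> {F. separated_set d f n \<epsilon> (topspace X) F}"
  then have sep: "separated_set d f n \<epsilon> (topspace X) F" and F: "F \<subseteq> topspace X"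
    by (auto simp: separated_set_def)
  define w where "w = (\<lambda>x. (1 / \<epsilon>) powr birkhoff_sum f n (\<lambda>x. \<phi> x - b * \<psi> x) x)"
  define D where "D = (1 / \<epsilon>) powr (\<bar>b\<bar> * m)"
  \<comment> \<open>Pieces have width \<open>m\<close> because the next step adds at least
    \<open>m\<close> and so crosses the level.\<close>
  define j where "j = (\<lambda>x. nat \<lceil>birkhoff_sum f n \<psi> x / m\<rceil>)"
  define J where "J = {..nat \<lceil>M / m * real n\<rceil>}"
  have "sum w F \<le> (M / m * real n + 2) * D"
  proof (cases "finite F \<and> F \<noteq> {}")
    \<comment> \<open>A sum over an infinite set is 0 by convention, so this case covers infinite
      \<open>F\<close> too.\<close>
    case False
    then have "sum w F = 0" by auto
    then show ?thesis
      using m_pos M_pos by (simp add: D_def)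
  next
    case True
    have j_in: "j ` F \<subseteq> J"
    proof safe
      fix x assume "x \<in> F"
      then have "birkhoff_sum f n \<psi> x / m \<le> M / m * real n"
        using roof_sum_le[of x n] F m_pos by (auto simp: field_simps)
      then show "j x \<in> J"
        unfolding j_def J_def atMost_iff by (intro nat_mono ceiling_mono)
    qed
    have fiber: "sum w {x \<in> F. j x = k} \<le> D" for k
    proof (cases "{x \<in> F. j x = k} = {}")
      case True
      then show ?thesis by (simp only: sum.empty) (simp add: D_def)
    next
      case False
      define T where "T = m * real k"
      have T: "birkhoff_sum f n \<psi> x \<le> T" "T < birkhoff_sum f n \<psi> x + m"
        if "x \<in> F" "j x = k" for x
      proof -
        have "x \<in> topspace X" using that F by blast
        \<comment> \<open>Nonnegativity keeps \<open>nat\<close> from truncating the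
          ceiling.\<close>
        then have "0 \<le> birkhoff_sum f n \<psi> x"
          using order_trans[OF _ roof_sum_ge, of 0 n x] m_pos by simp
        then have "real k = of_int \<lceil>birkhoff_sum f n \<psi> x / m\<rceil>"
          using that m_pos by (auto simp: j_def)
        then have "birkhoff_sum f n \<psi> x / m \<le> real k" "real k < birkhoff_sum f n \<psi> x / m + 1"
          by linarith+
        then show "birkhoff_sum f n \<psi> x \<le> T" "T < birkhoff_sum f n \<psi> x + m"
          using m_pos by (auto simp: T_def field_simps)
      qed
      \<comment> \<open>Only levels of nonempty pieces occur, and these are high enough for the
        assumed induced bound.\<close>
      have "T \<ge> m * real n"
      proof -
        obtain x where x: "x \<in> F" "j x = k" using False by blast
        then have "x \<in> topspace X" using F by blast
        from order_trans[OF roof_sum_ge[OF this] T(1)[OF x]] show ?thesis .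
      qed
      have "separated_set d f n \<epsilon> (exit_set X f \<psi> T n) {x \<in> F. j x = k}"
        unfolding separated_set_def
      proof safe
        fix x assume x: "x \<in> F" "k = j x"
        then have "x \<in> topspace X" using F by auto
        then show "x \<in> exit_set X f \<psi> T n"
          using T[of x] x roof_ge[OF funpow_in_topspace, of x n]
          by (auto simp: exit_set_def birkhoff_sum_Suc)
      next
        fix x y assume "x \<in> F" "y \<in> F" "x \<noteq> y"
        then show "\<epsilon> \<le> bowen_dist d f n x y"
          using sep by (auto simp: separated_set_def)
      qed
      then have ind: "(\<Sum>x | x \<in> F \<and> j x = k. (1 / \<epsilon>) powr birkhoff_sum f n \<phi> x) \<le> (1 / \<epsilon>) powr (b * T)"
        using order_trans[OF sum_powr_le_induced_sep_sum T0[OF \<open>T \<ge> m * real n\<close>]] \<open>n > 0\<close> by simp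
      have "sum w {x \<in> F. j x = k}
          \<le> (\<Sum>x | x \<in> F \<and> j x = k. D * (1 / \<epsilon>) powr (- (b * T)) * (1 / \<epsilon>) powr birkhoff_sum f n \<phi> x)"
      proof (rule sum_mono)
        fix x assume "x \<in> {x \<in> F. j x = k}"
        then have "\<bar>T - birkhoff_sum f n \<psi> x\<bar> \<le> m" using T[of x] by auto
        then have "\<bar>b\<bar> * \<bar>T - birkhoff_sum f n \<psi> x\<bar> \<le> \<bar>b\<bar> * m"
          by (intro mult_left_mono) auto
        then have "b * (T - birkhoff_sum f n \<psi> x) \<le> \<bar>b\<bar> * m"
          by (metis abs_ge_self abs_mult order_trans)
        then show "w x \<le> D * (1 / \<epsilon>) powr (- (b * T)) * (1 / \<epsilon>) powr birkhoff_sum f n \<phi> x"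
          unfolding w_def D_def powr_add[symmetric] using \<epsilon>
          by (intro powr_mono) (auto simp: birkhoff_sum_diff_scaled algebra_simps)
      qed
      also have "\<dots> = D * (1 / \<epsilon>) powr (- (b * T)) *
          (\<Sum>x | x \<in> F \<and> j x = k. (1 / \<epsilon>) powr birkhoff_sum f n \<phi> x)"
        by (simp add: sum_distrib_left)
      also have "\<dots> \<le> D * (1 / \<epsilon>) powr (- (b * T)) * (1 / \<epsilon>) powr (b * T)"
        using ind by (intro mult_left_mono) (auto simp: D_def)
      also have "\<dots> = D"
        using \<epsilon> by (simp add: powr_minus)
      finally show ?thesis .
    qed
    have "sum w F = (\<Sum>k\<in>J. sum w {x \<in> F. j x = k})"
      using True j_in by (intro sum.group[symmetric]) (auto simp: J_def)
    also have "\<dots> \<le> real (card J) * D"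
      using sum_bounded_above[of J "\<lambda>k. sum w {x \<in> F. j x = k}" D] fiber by simp
    also have "\<dots> \<le> (M / m * real n + 2) * D"
    proof (rule mult_right_mono)
      \<comment> \<open>Rounding up costs 1, and counting the index 0 costs another 1.\<close>
      have "0 \<le> M / m * real n" using M_pos m_pos by simp
      then show "real (card J) \<le> M / m * real n + 2"
        unfolding J_def card_atMost by linarith
    qed (simp add: D_def)
    finally show ?thesis .
  qed
  then show "ereal (\<Sum>x\<in>F. (1 / \<epsilon>) powr birkhoff_sum f n (\<lambda>x. \<phi> x - b * \<psi> x) x)
      \<le> ereal ((M / m * real n + 2) * (1 / \<epsilon>) powr (\<bar>b\<bar> * m))"
    by (simp add: w_def D_def)
qed

text \<open>If the induced quantity were below \<open>b\<close>, the sums for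
  \<open>\<phi> - b \<psi>\<close> would grow at most linearly in \<open>n\<close>, hence more
  slowly than \<open>(1 / \<epsilon>) powr (\<delta> * real n)\<close> for any
  \<open>\<delta> > 0\<close>.\<close>

lemma induced_upper_mdim_ge:
  assumes "0 < upper_mdim X f d (\<lambda>x. \<phi> x - b * \<psi> x)"
  shows "ereal b \<le> induced_upper_mdim X f d \<psi> \<phi>"
proof (rule ccontr)
  assume "\<not> ?thesis"
  then have less: "induced_upper_mdim X f d \<psi> \<phi> < ereal b" by simp
  obtain \<delta> where \<delta>: "0 < \<delta>" "ereal \<delta> < upper_mdim X f d (\<lambda>x. \<phi> x - b * \<psi> x)"
    using ereal_dense2[OF assms] by auto
  have "upper_mdim X f d (\<lambda>x. \<phi> x - b * \<psi> x) \<le> ereal \<delta>"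
  proof (rule upper_mdim_leI)
    show "eventually (\<lambda>\<epsilon>. eventually (\<lambda>n. sep_sum X f d (\<lambda>x. \<phi> x - b * \<psi> x) n \<epsilon>
        \<le> ereal ((1 / \<epsilon>) powr (\<delta> * real n))) sequentially) (at_right 0)"
      using Limsup_lessD[OF less[unfolded induced_upper_mdim_def]] eventually_at_right_0_less_1
    proof eventually_elim
      case (elim \<epsilon>)
      then have \<epsilon>: "0 < \<epsilon>" "\<epsilon> < 1" and ln: "ln (1 / \<epsilon>) > 0" by auto
      have "eventually (\<lambda>T. induced_sep_sum X f d \<psi> \<phi> T \<epsilon> \<le> ereal ((1 / \<epsilon>) powr (b * T))) at_top"
        using Limsup_lessD[OF elim(1)] eventually_gt_at_top[of 0]
      proof eventually_elim
        case (elim T)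
        then have "induced_sep_sum X f d \<psi> \<phi> T \<epsilon> \<le> ereal (exp (b / (1 / (T * ln (1 / \<epsilon>)))))"
          using ln by (subst scaled_ereal_ln_le_iff[symmetric]) auto
        then show ?case using \<epsilon> by (simp add: powr_def mult_ac)
      qed
      then obtain T0 where
        T0: "\<And>T. T \<ge> T0 \<Longrightarrow> induced_sep_sum X f d \<psi> \<phi> T \<epsilon> \<le> ereal ((1 / \<epsilon>) powr (b * T))"
        by (auto simp: eventually_at_top_linorder)
      define c where "c = \<delta> * ln (1 / \<epsilon>)"
      define D where "D = (1 / \<epsilon>) powr (\<bar>b\<bar> * m)"
      define A where "A = M / m"
      have "c > 0" using \<delta> ln by (simp add: c_def)
      then have "((\<lambda>n::nat. (A * real n + 2) * D / exp (c * real n)) \<longlongrightarrow> 0) sequentially"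
        by real_asymp
      then have "eventually (\<lambda>n::nat. (A * real n + 2) * D / exp (c * real n) < 1) sequentially"
        by (rule order_tendstoD) simp
      \<comment> \<open>For such \<open>n\<close> every level \<open>T \<ge> m * real n\<close> is
        at least \<open>T0\<close>.\<close>
      moreover have "eventually (\<lambda>n::nat. T0 / m \<le> real n) sequentially"
        using filterlim_real_sequentially by (simp add: filterlim_at_top)
      ultimately show ?case
        using eventually_gt_at_top[of 0]
      proof eventually_elim
        case (elim n)
        have "T0 \<le> m * real n" using elim(2) m_pos by (simp add: field_simps)
        then have "sep_sum X f d (\<lambda>x. \<phi> x - b * \<psi> x) n \<epsilon> \<le> ereal ((A * real n + 2) * D)"
          unfolding A_def D_def using T0 elim(3) \<epsilon> by (intro sep_sum_le_of_induced) auto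
        also have "\<dots> \<le> ereal (exp (c * real n))"
          using elim(1) by simp
        also have "exp (c * real n) = (1 / \<epsilon>) powr (\<delta> * real n)"
          using \<epsilon> by (simp add: c_def powr_def mult_ac)
        finally show ?case .
      qed
    qed
  qed
  with \<delta>(2) show False by simp
qed

section \<open>Existence of the root and the signs on its two sides\<close>

text \<open>Finite values give a real function of \<open>b\<close> that is Lipschitz and decreases
  at rate at least \<open>m\<close>, so the intermediate value theorem applies.\<close>

lemma upper_mdim_roof_root:
  assumes fin: "\<And>b. \<bar>upper_mdim X f d (\<lambda>x. \<phi> x - b * \<psi> x)\<bar> \<noteq> \<infinity>"
  obtains \<beta> where "upper_mdim X f d (\<lambda>x. \<phi> x - \<beta> * \<psi> x) = 0"
    "\<And>b. b < \<beta> \<Longrightarrow> 0 < upper_mdim X f d (\<lambda>x. \<phi> x - b * \<psi> x)"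
    "\<And>b. \<beta> < b \<Longrightarrow> upper_mdim X f d (\<lambda>x. \<phi> x - b * \<psi> x) < 0"
proof -
  define g where "g = (\<lambda>b. real_of_ereal (upper_mdim X f d (\<lambda>x. \<phi> x - b * \<psi> x)))"
  have g: "upper_mdim X f d (\<lambda>x. \<phi> x - b * \<psi> x) = ereal (g b)" for b
    using fin[of b] by (simp add: g_def ereal_real')
  have upper: "g b' \<le> g b - m * (b' - b)" if "b \<le> b'" for b b'
  \<comment> \<open>\<open>upper_mdim_mono\<close> transports only strict upper bounds, hence the
    slack \<open>e\<close>.\<close>
  proof (rule field_le_epsilon)
    fix e :: real assume "0 < e"
    have "\<phi> x - b' * \<psi> x \<le> \<phi> x - b * \<psi> x + (- (m * (b' - b)))" if "x \<in> topspace X" for x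
      using mult_right_mono[OF roof_ge[OF that], of "b' - b"] \<open>b \<le> b'\<close> by (simp add: algebra_simps)
    from upper_mdim_mono[of "\<lambda>x. \<phi> x - b' * \<psi> x", OF this, of d "g b + e"] \<open>0 < e\<close>
    show "g b' \<le> g b - m * (b' - b) + e" by (simp add: g)
  qed
  have lower: "g b \<le> g b' + M * (b' - b)" if "b \<le> b'" for b b'
  proof (rule field_le_epsilon)
    fix e :: real assume "0 < e"
    have "\<phi> x - b * \<psi> x \<le> \<phi> x - b' * \<psi> x + M * (b' - b)" if "x \<in> topspace X" for x
      using mult_right_mono[OF roof_le[OF that], of "b' - b"] \<open>b \<le> b'\<close> by (simp add: algebra_simps)
    from upper_mdim_mono[of "\<lambda>x. \<phi> x - b * \<psi> x", OF this, of d "g b' + e"] \<open>0 < e\<close>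
    show "g b \<le> g b' + M * (b' - b) + e" by (simp add: g)
  qed
  have strict: "g b' < g b" if "b < b'" for b b'
    using upper[of b b'] that m_pos mult_pos_pos[of m "b' - b"] by linarith
  have "M-lipschitz_on UNIV g"
  proof (rule lipschitz_onI)
    fix b b' :: real
    show "dist (g b) (g b') \<le> M * dist b b'"
      using lower[of b b'] lower[of b' b] strict[of b b'] strict[of b' b]
      by (cases b b' rule: linorder_cases) (auto simp: dist_real_def)
  qed (use M_pos in simp)
  then have cont: "continuous_on UNIV g" by (rule lipschitz_on_continuous_on)
  \<comment> \<open>Descent at rate at least \<open>m\<close> forces a sign change within this
    distance of 0.\<close>
  define r where "r = \<bar>g 0\<bar> / m"
  have r: "0 \<le> r" "m * r = \<bar>g 0\<bar>" using m_pos by (auto simp: r_def)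
  obtain \<beta> where \<beta>: "g \<beta> = 0"
  proof -
    have "g r \<le> 0" "0 \<le> g (- r)"
      using upper[of 0 r] upper[of "- r" 0] r by auto
    then show thesis
      using IVT2'[of g r 0 "- r"] r continuous_on_subset[OF cont] that by auto
  qed
  show thesis
    using that[of \<beta>] strict[of _ \<beta>] strict[of \<beta>] \<beta> by (simp add: g zero_ereal_def)
qed

end

section \<open>Identification of the induced dimension with the root\<close>

theorem theorem1p1:
  fixes X :: "'a topology" and f :: "'a \<Rightarrow> 'a" and d :: "'a \<Rightarrow> 'a \<Rightarrow> real"
    and \<phi> \<psi> :: "'a \<Rightarrow> real"
  assumes "tds X f"
    and "d \<in> compatible_metrics X"
    and "continuous_map X euclideanreal \<phi>"
    and "continuous_map X euclideanreal \<psi>"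
    and "\<forall>x\<in>topspace X. \<psi> x > 0"
    and "upper_mdim X f d \<phi> < \<infinity>"
  shows "\<exists>\<beta>::real. induced_upper_mdim X f d \<psi> \<phi> = ereal \<beta>
           \<and> upper_mdim X f d (\<lambda>x. \<phi> x - \<beta> * \<psi> x) = 0
           \<and> (\<forall>\<beta>'::real. upper_mdim X f d (\<lambda>x. \<phi> x - \<beta>' * \<psi> x) = 0 \<longrightarrow> \<beta>' = \<beta>)"
proof -
  have ne: "topspace X \<noteq> {}" and "compact_space X" and "continuous_map X X f"
    using assms(1) by (auto simp: tds_def)
  have compact: "compact (h ` topspace X)" if "continuous_map X euclideanreal h" for h
    using image_compactin[OF _ that, of "topspace X"] \<open>compact_space X\<close>
    by (simp add: compact_space_def)
  obtain m where m: "0 < m" "\<And>x. x \<in> topspace X \<Longrightarrow> m \<le> \<psi> x"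
    using compact_attains_inf[OF compact[OF assms(4)]] ne assms(5) by auto
  obtain M where M: "\<And>x. x \<in> topspace X \<Longrightarrow> \<psi> x \<le> M"
    using compact_attains_sup[OF compact[OF assms(4)]] ne by auto
  obtain L where L: "\<And>x. x \<in> topspace X \<Longrightarrow> L \<le> \<phi> x"
    using compact_attains_inf[OF compact[OF assms(3)]] ne by auto
  have "0 < M" using ne m M by (metis all_not_in_conv less_le_trans)
  interpret positive_roof X f \<psi> m M
    using m M \<open>0 < M\<close> \<open>continuous_map X X f\<close> by unfold_locales (auto simp: continuous_map_def)
  \<comment> \<open>Finiteness spreads from \<open>\<phi>\<close> to all \<open>b\<close> because
    \<open>b * \<psi> x\<close> is bounded; the lower bound of \<open>\<phi>\<close> excludes
    -infinity.\<close>
  have "\<bar>upper_mdim X f d (\<lambda>x. \<phi> x - b * \<psi> x)\<bar> \<noteq> \<infinity>" for b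
  proof -
    have b: "\<bar>b * \<psi> x\<bar> \<le> \<bar>b\<bar> * M" if "x \<in> topspace X" for x
      using m(1) m(2)[OF that] M[OF that] by (auto simp: abs_mult intro!: mult_left_mono)
    have "ereal (L - \<bar>b\<bar> * M) \<le> upper_mdim X f d (\<lambda>x. \<phi> x - b * \<psi> x)"
      using ne
    proof (rule upper_mdim_ge)
      show "L - \<bar>b\<bar> * M \<le> \<phi> x - b * \<psi> x" if "x \<in> topspace X" for x
        using L[OF that] b[OF that] by linarith
    qed
    moreover obtain a where "upper_mdim X f d \<phi> < ereal a"
      using ereal_dense2[OF assms(6)] by auto
    then have "upper_mdim X f d (\<lambda>x. \<phi> x - b * \<psi> x) < ereal (a + \<bar>b\<bar> * M)"
    proof (rule upper_mdim_mono[rotated])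
      show "\<phi> x - b * \<psi> x \<le> \<phi> x + \<bar>b\<bar> * M" if "x \<in> topspace X" for x
        using b[OF that] by linarith
    qed
    ultimately show ?thesis by auto
  qed
  then obtain \<beta> where root: "upper_mdim X f d (\<lambda>x. \<phi> x - \<beta> * \<psi> x) = 0"
    and pos: "\<And>b. b < \<beta> \<Longrightarrow> 0 < upper_mdim X f d (\<lambda>x. \<phi> x - b * \<psi> x)"
    and neg: "\<And>b. \<beta> < b \<Longrightarrow> upper_mdim X f d (\<lambda>x. \<phi> x - b * \<psi> x) < 0"
    using upper_mdim_roof_root by blast
  have "induced_upper_mdim X f d \<psi> \<phi> = ereal \<beta>"
  proof (rule antisym)
    show "induced_upper_mdim X f d \<psi> \<phi> \<le> ereal \<beta>"
    proof (rule dense_ge)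
      fix c assume "ereal \<beta> < c"
      then obtain b' where b': "\<beta> < b'" "ereal b' < c"
        using ereal_dense2 by (metis ereal_less_eq(3) less_ereal.simps(1))
      \<comment> \<open>Two gaps are required: \<open>\<beta> < b\<close> for a negative dimension,
        \<open>b < b'\<close> for absorbing the constant.\<close>
      then obtain b where "\<beta> < b" "b < b'" using dense by blast
      then have "induced_upper_mdim X f d \<psi> \<phi> \<le> ereal b'"
        using induced_upper_mdim_le neg by blast
      with b' show "induced_upper_mdim X f d \<psi> \<phi> \<le> c" by simp
    qed
    show "ereal \<beta> \<le> induced_upper_mdim X f d \<psi> \<phi>"
    proof (rule dense_le)
      fix c assume "c < ereal \<beta>"
      then obtain b where b: "b < \<beta>" "c < ereal b"
        using ereal_dense2 by (metis less_ereal.simps(1))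
      with induced_upper_mdim_ge[OF pos] show "c \<le> induced_upper_mdim X f d \<psi> \<phi>"
        by (meson less_imp_le order_trans)
    qed
  qed
  moreover have "\<beta>' = \<beta>" if "upper_mdim X f d (\<lambda>x. \<phi> x - \<beta>' * \<psi> x) = 0" for \<beta>'
    using that pos[of \<beta>'] neg[of \<beta>'] by (cases \<beta>' \<beta> rule: linorder_cases) auto
  ultimately show ?thesis
    using root by blast
qed

end
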